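(* For all odd positive integers $n$, $$t(n) \leq 0.125\, n^2 .$$
   Context: For a positive integer $n$ let $[n]=\{1,\dots,n\}$. The $n\times n$ torus $\mathbb{T}_n$ is the hypergraph with vertex set $[n]\times[n]$ whose hyperedges are: the rows $\{i\}\times[n]$ for $i\in[n]$; the columns $[n]\times\{j\}$ for $j\in[n]$; the $\mathbb{Z}_n$-diagonals $\{(i,j)\in[n]\times[n] : i-j\equiv k \pmod n\}$ for $k\in\mathbb{Z}_n$; and the $\mathbb{Z}_n$-skew-diagonals $\{(i,j)\in[n]\times[n] : i+j\equiv k \pmod n\}$ for $k\in\mathbb{Z}_n$. A peaceful battle on $\mathbb{T}_n$ is a pair $(B,W)$ of disjoint subsets of $[n]\times[n]$ such that $e\cap B=\emptyset$ or $e\cap W=\emptyset$ for every hyperedge $e$ of $\mathbb{T}_n$. The number $t(n)$ is the maximum integer $m$ such that there is a peaceful battle $(B,W)$ on $\mathbb{T}_n$ with $|B|=|W|=m$. *)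

theory Defs
  imports Complex_Main "HOL-Number_Theory.Cong"
begin

definition torus_verts :: "nat \<Rightarrow> (nat \<times> nat) set" where
  "torus_verts n = {1..n} \<times> {1..n}"

definition torus_row :: "nat \<Rightarrow> nat \<Rightarrow> (nat \<times> nat) set" where
  "torus_row n i = {i} \<times> {1..n}"

definition torus_col :: "nat \<Rightarrow> nat \<Rightarrow> (nat \<times> nat) set" where
  "torus_col n j = {1..n} \<times> {j}"

text \<open>Coordinates are taken to the integers first, since subtraction on natural numbers truncates.\<close>

definition torus_diag :: "nat \<Rightarrow> int \<Rightarrow> (nat \<times> nat) set" where
  "torus_diag n k = {(i, j) \<in> torus_verts n. [int i - int j = k] (mod int n)}"

definition torus_skew :: "nat \<Rightarrow> int \<Rightarrow> (nat \<times> nat) set" where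
  "torus_skew n k = {(i, j) \<in> torus_verts n. [int i + int j = k] (mod int n)}"

text \<open>The elements of \<open>\<int>\<^sub>n\<close> are represented by the residues \<open>0, \<dots>, n - 1\<close>.\<close>

definition torus_edges :: "nat \<Rightarrow> (nat \<times> nat) set set" where
  "torus_edges n =
     torus_row n ` {1..n} \<union> torus_col n ` {1..n} \<union>
     torus_diag n ` {0..<int n} \<union> torus_skew n ` {0..<int n}"

definition peaceful_battle :: "nat \<Rightarrow> (nat \<times> nat) set \<Rightarrow> (nat \<times> nat) set \<Rightarrow> bool" where
  "peaceful_battle n B W \<longleftrightarrow>
     B \<subseteq> torus_verts n \<and> W \<subseteq> torus_verts n \<and> B \<inter> W = {} \<and>
     (\<forall>e \<in> torus_edges n. e \<inter> B = {} \<or> e \<inter> W = {})"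

definition battle_sizes :: "nat \<Rightarrow> nat set" where
  "battle_sizes n = {m. \<exists>B W. peaceful_battle n B W \<and> card B = m \<and> card W = m}"

definition torus_t :: "nat \<Rightarrow> nat" where
  "torus_t n = Max (battle_sizes n)"

text \<open>\<open>Max\<close> is only meaningful on a finite nonempty set, which the next two facts provide.\<close>

lemma finite_battle_sizes: "finite (battle_sizes n)"
proof (rule finite_subset)
  show "battle_sizes n \<subseteq> card ` Pow (torus_verts n)"
    by (auto simp: battle_sizes_def peaceful_battle_def)
  show "finite (card ` Pow (torus_verts n))"
    by (simp add: torus_verts_def)
qed

lemma zero_in_battle_sizes: "0 \<in> battle_sizes n"
  unfolding battle_sizes_def peaceful_battle_def
  by (auto intro!: exI[of _ "{}"])

end

theory Submission
  imports Defs "HOL-Analysis.Convex"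
begin

text \<open>
  Colour a line black if it meets \<open>B\<close>.  For odd \<open>n\<close> any two lines from different ones of the four
  parallel classes (rows, columns, diagonals, skew-diagonals) meet in exactly one vertex.
  Hence for a uniformly random vertex the colours of the four lines through it are \<^emph>\<open>pairwise\<close>
  independent, and the number \<open>S\<close> of black lines through the vertex has variance
  \<open>\<Sum>k. p k * (1 - p k)\<close>, where \<open>p k\<close> is the proportion of black lines in the class \<open>k\<close>.
  With \<open>P = \<Sum>k. p k\<close> this variance is at most \<open>P * (4 - P) / 4\<close>.

  On the other hand \<open>S = 4\<close> on \<open>B\<close> and \<open>S = 0\<close> on \<open>W\<close>, two values far from the mean \<open>P\<close>.
  If both sets have \<open>m\<close> elements, the variance is therefore at least
  \<open>m * ((4 - P)\<^sup>2 + P\<^sup>2) / n\<^sup>2\<close>.  Comparing the two bounds gives \<open>m \<le> n\<^sup>2 / 8\<close>,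
  the extreme case being \<open>P = 2\<close>: moving \<open>P\<close> away from \<open>2\<close> lowers the upper bound and raises
  the lower one.

  The argument works for \<open>r\<close> pairwise orthogonal parallel classes and gives \<open>2 * r * m \<le> n\<^sup>2\<close>
  (\<open>separated_sets_bound\<close>).  The torus enters only through the fact that
  two linear forms over \<open>\<int>\<^sub>n\<close> are orthogonal in this sense when their determinant is a unit
  (\<open>bij_betw_torus_forms\<close>); the determinants that occur are \<open>\<plusminus>1\<close> and \<open>\<plusminus>2\<close>.
\<close>

section \<open>Pairwise orthogonal parallel classes\<close>

text \<open>
  A combinatorial net: \<open>V\<close> is the set of points, \<open>K\<close> indexes the parallel classes, and
  \<open>f k v\<close> is the label in \<open>L\<close> of the line of class \<open>k\<close> through \<open>v\<close>.
  With at least two classes, orthogonality also forces every line to have \<open>card L\<close> points.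
\<close>

locale orthogonal_classes =
  fixes V :: "'v set" and K :: "'k set" and L :: "'l set" and f :: "'k \<Rightarrow> 'v \<Rightarrow> 'l"
  assumes finite_V: "finite V"
    and finite_K: "finite K"
    and two_classes: "2 \<le> card K"
    and finite_L: "finite L"
    and L_nonempty: "L \<noteq> {}"
    and orthogonal: "\<And>k l. k \<in> K \<Longrightarrow> l \<in> K \<Longrightarrow> k \<noteq> l \<Longrightarrow> bij_betw (\<lambda>v. (f k v, f l v)) V (L \<times> L)"
begin

lemma sum_product_orthogonal:
  fixes g h :: "'l \<Rightarrow> real"
  assumes "k \<in> K" "l \<in> K" "k \<noteq> l"
  shows "(\<Sum>v\<in>V. g (f k v) * h (f l v)) = (\<Sum>x\<in>L. g x) * (\<Sum>y\<in>L. h y)"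
proof -
  have "(\<Sum>v\<in>V. g (f k v) * h (f l v)) = (\<Sum>(x, y)\<in>L \<times> L. g x * h y)"
    using sum.reindex_bij_betw[OF orthogonal[OF assms], of "\<lambda>(x, y). g x * h y"] by simp
  also have "\<dots> = (\<Sum>x\<in>L. g x) * (\<Sum>y\<in>L. h y)"
    by (simp add: sum_product sum.cartesian_product)
  finally show ?thesis .
qed

lemma sum_label:
  fixes g :: "'l \<Rightarrow> real"
  assumes "k \<in> K"
  shows "(\<Sum>v\<in>V. g (f k v)) = real (card L) * (\<Sum>x\<in>L. g x)"
proof -
  have "\<not> K \<subseteq> {k}"
    using two_classes card_mono[of "{k}" K] by auto
  then obtain l where "l \<in> K" "l \<noteq> k" by auto
  then show ?thesis
    using sum_product_orthogonal[of k l g "\<lambda>_. 1"] assms by (simp add: mult.commute)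
qed

text \<open>
  This is additivity of the variance for pairwise independent variables: the mixed terms of the
  expanded square vanish because each factor has sum zero.
\<close>

lemma sum_square_centred:
  fixes u :: "'k \<Rightarrow> 'l \<Rightarrow> real"
  assumes centred: "\<And>k. k \<in> K \<Longrightarrow> (\<Sum>x\<in>L. u k x) = 0"
  shows "(\<Sum>v\<in>V. (\<Sum>k\<in>K. u k (f k v))\<^sup>2) = real (card L) * (\<Sum>k\<in>K. \<Sum>x\<in>L. (u k x)\<^sup>2)"
proof -
  have mixed: "(\<Sum>v\<in>V. u k (f k v) * u l (f l v))
      = (if k = l then real (card L) * (\<Sum>x\<in>L. (u k x)\<^sup>2) else 0)" if "k \<in> K" "l \<in> K" for k l
    using that sum_product_orthogonal[of k l "u k" "u l"] sum_label[of k "\<lambda>x. (u k x)\<^sup>2"] centred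
    by (auto simp: power2_eq_square)
  have "(\<Sum>v\<in>V. (\<Sum>k\<in>K. u k (f k v))\<^sup>2) = (\<Sum>v\<in>V. \<Sum>k\<in>K. \<Sum>l\<in>K. u k (f k v) * u l (f l v))"
    by (simp add: power2_eq_square sum_product)
  also have "\<dots> = (\<Sum>k\<in>K. \<Sum>l\<in>K. \<Sum>v\<in>V. u k (f k v) * u l (f l v))"
    by (subst sum.swap, rule sum.cong[OF refl], rule sum.swap)
  also have "\<dots> = (\<Sum>k\<in>K. real (card L) * (\<Sum>x\<in>L. (u k x)\<^sup>2))"
    using finite_K by (simp add: mixed cong: sum.cong)
  finally show ?thesis by (simp add: sum_distrib_left)
qed

text \<open>
  The second-moment argument: the number of lines through a point that meet \<open>B\<close> takes its two
  extreme values on \<open>B\<close> and on \<open>W\<close>, so large \<open>B\<close> and \<open>W\<close> force more variance than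
  pairwise independent colours can have.
\<close>

lemma separated_sets_bound:
  assumes B: "B \<subseteq> V" and W: "W \<subseteq> V" and card_B: "card B = m" and card_W: "card W = m"
    and separated: "\<And>k b w. k \<in> K \<Longrightarrow> b \<in> B \<Longrightarrow> w \<in> W \<Longrightarrow> f k b \<noteq> f k w"
  shows "2 * real (card K) * real m \<le> (real (card L))\<^sup>2"
proof -
  define n where "n = real (card L)"
  define r where "r = real (card K)"
  define x where "x k l = (if l \<in> f k ` B then 1 else 0 :: real)" for k l
  define p where "p k = (\<Sum>l\<in>L. x k l) / n" for k
  define u where "u k l = x k l - p k" for k l
  define P where "P = (\<Sum>k\<in>K. p k)"
  have n: "n > 0" using finite_L L_nonempty by (simp add: n_def card_gt_0_iff)
  have r: "r > 0" using two_classes by (simp add: r_def)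
  have sum_x: "(\<Sum>l\<in>L. x k l) = n * p k" for k using n by (simp add: p_def)
  have centred: "(\<Sum>l\<in>L. u k l) = 0" for k
    by (simp add: u_def sum_subtractf sum_x flip: n_def)
  have u_squares: "(\<Sum>l\<in>L. (u k l)\<^sup>2) = n * (p k - (p k)\<^sup>2)" for k
  proof -
    have "(u k l)\<^sup>2 = (1 - 2 * p k) * x k l + (p k)\<^sup>2" for l
      by (simp add: u_def x_def power2_eq_square algebra_simps)
    then have "(\<Sum>l\<in>L. (u k l)\<^sup>2) = (1 - 2 * p k) * (n * p k) + n * (p k)\<^sup>2"
      by (simp add: sum.distrib sum_x flip: sum_distrib_left n_def)
    then show ?thesis by (simp add: power2_eq_square algebra_simps)
  qed
  have on_B: "(\<Sum>k\<in>K. u k (f k v)) = r - P" if "v \<in> B" for v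
    using that by (simp add: u_def x_def P_def r_def sum_subtractf)
  have on_W: "(\<Sum>k\<in>K. u k (f k v)) = - P" if "v \<in> W" for v
  proof -
    have "x k (f k v) = 0" if "k \<in> K" for k
      using separated[OF that _ \<open>v \<in> W\<close>] unfolding x_def by force
    then show ?thesis by (simp add: u_def P_def sum_negf)
  qed
  have disjoint: "B \<inter> W = {}"
  proof -
    obtain k where "k \<in> K" using two_classes by fastforce
    then show ?thesis using separated by blast
  qed
  have finite: "finite B" "finite W" using B W finite_V by (auto intro: finite_subset)
  have "real m * ((r - P)\<^sup>2 + P\<^sup>2)
      = (\<Sum>v\<in>B. (\<Sum>k\<in>K. u k (f k v))\<^sup>2) + (\<Sum>v\<in>W. (\<Sum>k\<in>K. u k (f k v))\<^sup>2)"
    by (simp add: on_B on_W card_B card_W algebra_simps)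
  also have "\<dots> = (\<Sum>v\<in>B \<union> W. (\<Sum>k\<in>K. u k (f k v))\<^sup>2)"
    using finite disjoint by (simp add: sum.union_disjoint)
  also have "\<dots> \<le> (\<Sum>v\<in>V. (\<Sum>k\<in>K. u k (f k v))\<^sup>2)"
    using B W finite_V by (intro sum_mono2) auto
  also have "\<dots> = n\<^sup>2 * (P - (\<Sum>k\<in>K. (p k)\<^sup>2))"
    by (simp add: sum_square_centred[OF centred] u_squares P_def sum_subtractf power2_eq_square[of n]
        flip: n_def sum_distrib_left)
  finally have variance: "real m * ((r - P)\<^sup>2 + P\<^sup>2) \<le> n\<^sup>2 * (P - (\<Sum>k\<in>K. (p k)\<^sup>2))" .
  have "P\<^sup>2 \<le> r * (\<Sum>k\<in>K. (p k)\<^sup>2)"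
    using Cauchy_Schwarz_ineq_sum[of "\<lambda>_. 1" p K] by (simp add: P_def r_def)
  then have "r * (P - (\<Sum>k\<in>K. (p k)\<^sup>2)) \<le> P * (r - P)"
    by (simp add: algebra_simps power2_eq_square)
  (* The left-hand side of the variance bound is m * (r^2 - 2 * P * (r - P)), so a bound on
     P * (r - P) serves both sides. *)
  moreover have mean: "P * (r - P) \<le> r\<^sup>2 / 4"
    using zero_le_power2[of "r - 2 * P"] by (simp add: power2_eq_square algebra_simps)
  ultimately have "r * (P - (\<Sum>k\<in>K. (p k)\<^sup>2)) \<le> r * (r / 4)"
    by (simp add: power2_eq_square)
  then have "P - (\<Sum>k\<in>K. (p k)\<^sup>2) \<le> r / 4"
    using r by (rule mult_left_le_imp_le)
  then have "n\<^sup>2 * (P - (\<Sum>k\<in>K. (p k)\<^sup>2)) \<le> n\<^sup>2 * (r / 4)"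
    by (intro mult_left_mono) auto
  moreover have "real m * (r\<^sup>2 / 2) \<le> real m * ((r - P)\<^sup>2 + P\<^sup>2)"
    using mean by (intro mult_left_mono) (auto simp: power2_eq_square algebra_simps)
  ultimately have "real m * (r\<^sup>2 / 2) \<le> n\<^sup>2 * (r / 4)" using variance by linarith
  then have "r * (2 * r * real m) \<le> r * n\<^sup>2"
    by (simp add: power2_eq_square algebra_simps)
  then show ?thesis using r by (simp add: n_def r_def)
qed

end

section \<open>Linear forms on the torus\<close>

text \<open>
  The lines of the torus are the level sets of linear forms over \<open>\<int>\<^sub>n\<close>; a form is given by its
  pair of coefficients.
\<close>

definition torus_form :: "nat \<Rightarrow> int \<times> int \<Rightarrow> nat \<times> nat \<Rightarrow> int" where
  "torus_form n = (\<lambda>(a, b) (i, j). (a * int i + b * int j) mod int n)"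

lemma eq_if_cong_in_interval:
  assumes "i \<in> {1..n}" "i' \<in> {1..n}" "[int i = int i'] (mod int n)"
  shows "i = i'"
proof -
  have "int n dvd int i - int i'" using assms(3) by (simp add: cong_iff_dvd_diff)
  moreover have "\<bar>int i - int i'\<bar> < int n" using assms(1,2) by auto
  ultimately have "int i - int i' = 0" using dvd_imp_le_int[of "int i - int i'" "int n"] by linarith
  then show ?thesis by simp
qed

text \<open>
  Cramer's rule: a vector on which both forms vanish is killed by their determinant.
  Injectivity then suffices, since both sides have \<open>n\<^sup>2\<close> elements.
\<close>

lemma bij_betw_torus_forms:
  assumes n: "0 < n" and det: "coprime (a * d - b * c) (int n)"
  shows "bij_betw (\<lambda>v. (torus_form n (a, b) v, torus_form n (c, d) v))
           (torus_verts n) ({0..<int n} \<times> {0..<int n})"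
proof -
  let ?F = "\<lambda>v. (torus_form n (a, b) v, torus_form n (c, d) v)"
  have inj: "inj_on ?F (torus_verts n)"
  proof (rule inj_onI)
    fix v v' assume v: "v \<in> torus_verts n" "v' \<in> torus_verts n" and eq: "?F v = ?F v'"
    obtain i j i' j' where ij: "v = (i, j)" "v' = (i', j')" by (cases v, cases v') auto
    define x where "x = int i - int i'"
    define y where "y = int j - int j'"
    have 1: "int n dvd a * x + b * y" and 2: "int n dvd c * x + d * y"
      using eq by (auto simp: ij torus_form_def mod_eq_dvd_iff x_def y_def algebra_simps)
    have "int n dvd d * (a * x + b * y) - b * (c * x + d * y)"
      using 1 2 by (intro dvd_diff dvd_mult)
    then have "int n dvd (a * d - b * c) * x" by (simp add: algebra_simps)
    then have x: "int n dvd x"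
      using det by (simp add: coprime_dvd_mult_right_iff coprime_commute)
    have "int n dvd a * (c * x + d * y) - c * (a * x + b * y)"
      using 1 2 by (intro dvd_diff dvd_mult)
    then have "int n dvd (a * d - b * c) * y" by (simp add: algebra_simps)
    then have y: "int n dvd y"
      using det by (simp add: coprime_dvd_mult_right_iff coprime_commute)
    show "v = v'"
      using x y v eq_if_cong_in_interval[of i n i'] eq_if_cong_in_interval[of j n j']
      by (simp add: ij x_def y_def torus_verts_def cong_iff_dvd_diff)
  qed
  have "?F ` torus_verts n \<subseteq> {0..<int n} \<times> {0..<int n}"
    using n by (auto simp: torus_form_def)
  moreover have "card (?F ` torus_verts n) = card ({0..<int n} \<times> {0..<int n})"
    by (simp add: card_image[OF inj]) (simp add: torus_verts_def)
  ultimately have "?F ` torus_verts n = {0..<int n} \<times> {0..<int n}"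
    by (intro card_subset_eq) auto
  with inj show ?thesis by (simp add: bij_betw_def)
qed

section \<open>Peaceful battles\<close>

text \<open>Rows, columns, diagonals and skew-diagonals, in this order.\<close>

definition queen_forms :: "(int \<times> int) set" where
  "queen_forms = {(1, 0), (0, 1), (1, - 1), (1, 1)}"

text \<open>
  The diagonals and the skew-diagonals have determinant \<open>\<plusminus>2\<close>, which is a unit modulo \<open>n\<close>
  because \<open>n\<close> is odd; this is the only place where parity matters.
\<close>

lemma orthogonal_classes_queen_forms:
  assumes "0 < n" "odd n"
  shows "orthogonal_classes (torus_verts n) queen_forms {0..<int n} (torus_form n)"
proof
  fix k l assume "k \<in> queen_forms" "l \<in> queen_forms" "k \<noteq> l"
  then have "fst k * snd l - snd k * fst l \<in> {1, - 1, 2, - 2}"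
    by (auto simp: queen_forms_def)
  moreover have "coprime 2 (int n)" using assms(2) by simp
  ultimately have "coprime (fst k * snd l - snd k * fst l) (int n)" by auto
  from bij_betw_torus_forms[OF assms(1) this]
  show "bij_betw (\<lambda>v. (torus_form n k v, torus_form n l v))
          (torus_verts n) ({0..<int n} \<times> {0..<int n})" by simp
next
  show "finite (torus_verts n)" by (simp add: torus_verts_def)
  show "finite queen_forms" by (simp add: queen_forms_def)
  show "2 \<le> card queen_forms" by (simp add: queen_forms_def)
  show "{0..<int n} \<noteq> {}" using assms(1) by simp
qed simp

lemma same_level_imp_common_edge:
  assumes n: "0 < n" and k: "k \<in> queen_forms"
    and v: "v \<in> torus_verts n" and w: "w \<in> torus_verts n"
    and eq: "torus_form n k v = torus_form n k w"
  shows "\<exists>e \<in> torus_edges n. v \<in> e \<and> w \<in> e"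
proof -
  obtain i j i' j' where ij: "v = (i, j)" "w = (i', j')" by (cases v, cases w) auto
  have range: "i \<in> {1..n}" "j \<in> {1..n}" "i' \<in> {1..n}" "j' \<in> {1..n}"
    using v w by (auto simp: ij torus_verts_def)
  consider "k = (1, 0)" | "k = (0, 1)" | "k = (1, - 1)" | "k = (1, 1)"
    using k by (auto simp: queen_forms_def)
  then show ?thesis
  proof cases
    case 1
    have "[int i = int i'] (mod int n)"
      using eq by (simp add: 1 ij torus_form_def cong_def)
    then have "i = i'" using range by (intro eq_if_cong_in_interval)
    then have "v \<in> torus_row n i" "w \<in> torus_row n i" "torus_row n i \<in> torus_edges n"
      using range by (auto simp: ij torus_row_def torus_edges_def)
    then show ?thesis by blast
  next
    case 2
    have "[int j = int j'] (mod int n)"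
      using eq by (simp add: 2 ij torus_form_def cong_def)
    then have "j = j'" using range by (intro eq_if_cong_in_interval)
    then have "v \<in> torus_col n j" "w \<in> torus_col n j" "torus_col n j \<in> torus_edges n"
      using range by (auto simp: ij torus_col_def torus_edges_def)
    then show ?thesis by blast
  next
    case 3
    define e where "e = torus_diag n (torus_form n k v)"
    have "v \<in> e"
      using v by (simp add: e_def 3 ij torus_diag_def torus_form_def cong_def)
    moreover have "w \<in> e"
      using w unfolding e_def eq by (simp add: 3 ij torus_diag_def torus_form_def cong_def)
    moreover have "torus_form n k v \<in> {0..<int n}"
      using n by (simp add: 3 ij torus_form_def)
    then have "e \<in> torus_edges n" unfolding e_def torus_edges_def by blast
    ultimately show ?thesis by blast
  next
    case 4
    define e where "e = torus_skew n (torus_form n k v)"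
    have "v \<in> e"
      using v by (simp add: e_def 4 ij torus_skew_def torus_form_def cong_def)
    moreover have "w \<in> e"
      using w unfolding e_def eq by (simp add: 4 ij torus_skew_def torus_form_def cong_def)
    moreover have "torus_form n k v \<in> {0..<int n}"
      using n by (simp add: 4 ij torus_form_def)
    then have "e \<in> torus_edges n" unfolding e_def torus_edges_def by blast
    ultimately show ?thesis by blast
  qed
qed

theorem theorem1p4:
  fixes n :: nat
  assumes "0 < n" and "odd n"
  shows "real (torus_t n) \<le> 0.125 * (real n)\<^sup>2"
proof -
  interpret orthogonal_classes "torus_verts n" queen_forms "{0..<int n}" "torus_form n"
    using orthogonal_classes_queen_forms[OF assms] .
  have "torus_t n \<in> battle_sizes n"
    unfolding torus_t_def using finite_battle_sizes zero_in_battle_sizes by (intro Max_in) auto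
  then obtain B W where battle: "peaceful_battle n B W"
    and cards: "card B = torus_t n" "card W = torus_t n"
    by (auto simp: battle_sizes_def)
  have sub: "B \<subseteq> torus_verts n" "W \<subseteq> torus_verts n"
    using battle by (auto simp: peaceful_battle_def)
  have separated: "torus_form n k b \<noteq> torus_form n k w"
    if k: "k \<in> queen_forms" and b: "b \<in> B" and w: "w \<in> W" for k b w
  proof
    assume eq: "torus_form n k b = torus_form n k w"
    obtain e where e: "e \<in> torus_edges n" "b \<in> e" "w \<in> e"
      using same_level_imp_common_edge[OF assms(1) k _ _ eq] sub b w by blast
    have "e \<inter> B = {} \<or> e \<inter> W = {}" using battle e(1) by (simp add: peaceful_battle_def)
    then show False using e(2,3) b w by blast
  qed
  have "2 * real (card queen_forms) * real (torus_t n) \<le> (real (card {0..<int n}))\<^sup>2"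
    by (rule separated_sets_bound[OF sub cards separated])
  moreover have "card queen_forms = 4" by (simp add: queen_forms_def)
  ultimately show ?thesis by simp
qed

end
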